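(* Let $\mathcal F=\{a_1,\dots,a_s\}$ and $\mathcal R=\{r_1(m_1),\dots,r_\ell(m_\ell)\}$ be the collections of forbidden and repeated words respectively, over a symbol set $\Sigma$ of size $q\ge2$, where $m_j>1$ for all $1\le j\le\ell$. If $\mathcal F\cup\mathcal R$ is reduced, then the generating functions $F(z)$, $G_{r_j}(z)$ and $F_{a_i}(z)$ satisfy the following system of linear equations: $$(z-q)F(z)-\sum_{j=1}^{\ell}z\Bigl(1-\frac1{m_j}\Bigr)G_{r_j}(z)+\sum_{i=1}^{s}zF_{a_i}(z)=z,$$ $$F(z)+\sum_{j=1}^{\ell}\Bigl[z\Bigl(1-\frac1{m_j}\Bigr)(r_j,r_k)_z-z^{|r_j|}\delta_{jk}\Bigr]G_{r_j}(z)-\sum_{i=1}^{s}z(a_i,r_k)_zF_{a_i}(z)=0,\qquad 1\le k\le\ell,$$ $$F(z)+\sum_{j=1}^{\ell}\Bigl[z\Bigl(1-\frac1{m_j}\Bigr)(r_j,a_k)_z\Bigr]G_{r_j}(z)-\sum_{i=1}^{s}z(a_i,a_k)_zF_{a_i}(z)=0,\qquad 1\le k\le s,$$ where $\delta_{jk}=1$ if $j=k$, and $\delta_{jk}=0$ otherwise.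
   Context: $\Sigma$ is a finite set of $q$ symbols; a word is a finite sequence over $\Sigma$ and $|w|$ is its length. A finite collection of words is reduced if for any two distinct words in it, neither is a (contiguous) subword of the other. $\mathcal F$ is a finite reduced collection of words of length at least $2$, and $\Sigma_{\mathcal F}$ is the set of all one-sided infinite sequences over $\Sigma$ that contain no word of $\mathcal F$ as a subword. A word is allowed if it is a subword of some sequence in $\Sigma_{\mathcal F}$; $\mathcal L_n$ is the set of allowed words of length $n$. It is assumed that every symbol of $\Sigma$ is allowed and that $\Sigma_{\mathcal F}$ is irreducible, that is, if $p_0$ is the length of the longest word in $\mathcal F$, the following binary matrix $B$ indexed by $\mathcal L_{p_0-1}$ is irreducible (for all $X,Y$ some power $B^m$ has positive $XY$ entry): $B_{XY}=1$ if the last $p_0-2$ symbols of $X$ are the first $p_0-2$ symbols of $Y$ and the word formed by $X$ followed by the last symbol of $Y$ lies in $\mathcal L_{p_0}$, and $B_{XY}=0$ otherwise. $\mathcal R$ is a finite reduced collection of allowed words $r_1,\dots,r_\ell$, each $r_j$ being assigned an integer multiplicity $m_j\ge2$. Let $n(u;v)$ be the number of occurrences of $v$ as a subword of $u$. For an allowed word $w$ put $m(w)=\prod_{j=1}^{\ell}m_j^{n(w;r_j)}$. For a word $w$ that ends with some $a_i\in\mathcal F$, this $a_i$ at the end being the only occurrence of a word of $\mathcal F$ in $w$, put $$m(w)=\frac{\prod_{j=1}^{\ell}m_j^{n(w;r_j)}}{\prod_{j=1}^{\ell}m_j^{n(a_i;r_j)}}.$$ For $n\ge1$: $f(n)=\sum_{w\in\mathcal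 L_n}m(w)$; $g_{r_j}(n)=\sum m(w)$ over all $w\in\mathcal L_n$ that end with $r_j$; $f_{a_i}(n)=\sum m(w)$ over all words $w$ of length $n$ over $\Sigma$ that end with $a_i$ and in which this $a_i$ is the only occurrence of a word of $\mathcal F$. By convention $f(0)=1$, $g_{r_j}(0)=0$, $f_{a_i}(0)=0$. The generating functions are $$F(z)=\sum_{n\ge0}f(n)z^{-n},\quad G_{r_j}(z)=\sum_{n\ge0}g_{r_j}(n)z^{-n}\ (1\le j\le\ell),\quad F_{a_i}(z)=\sum_{n\ge0}f_{a_i}(n)z^{-n}\ (1\le i\le s).$$ Correlation: for words $u,v$, $(u,v)=(c_1,\dots,c_{|u|})$, where $c_i=1$ if, on placing $v$ below $u$ so that the leftmost symbol of $v$ lies under the $i$-th symbol of $u$ from the left, the overlapping segments of $u$ and $v$ are identical, and $c_i=0$ otherwise. The correlation polynomial is $(u,v)_z=\sum_{i=1}^{|u|}c_iz^{|u|-i}$.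
   Formalization: It is additionally assumed that every finite word containing no word of F is allowed (without this the first equation fails, e.g. Σ={0,1,2}, F={020,021,022}, R={11(2)}), and that the repeated words are nonempty. *)

theory Defs
  imports
    Complex_Main
    "HOL-Library.Cardinality"
    "HOL-Library.Sublist"
    "HOL-Computational_Algebra.Formal_Laurent_Series"
begin

text \<open>
  Words over the alphabet \<open>\<Sigma>\<close> are lists over a finite type \<open>'a\<close>, with \<open>q = CARD('a)\<close>; one-sided
  infinite sequences are functions \<open>nat \<Rightarrow> 'a\<close>. Throughout, \<open>F\<close> is the set of forbidden words,
  \<open>R\<close> the set of repeated words, and \<open>m r\<close> the multiplicity of \<open>r \<in> R\<close>.
\<close>

definition reduced :: "'a list set \<Rightarrow> bool" where
  "reduced C \<longleftrightarrow> finite C \<and> (\<forall>u\<in>C. \<forall>v\<in>C. u \<noteq> v \<longrightarrow> \<not> sublist u v)"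

definition subword_seq :: "'a list \<Rightarrow> (nat \<Rightarrow> 'a) \<Rightarrow> bool" where
  "subword_seq u x \<longleftrightarrow> (\<exists>i. map x [i..<i + length u] = u)"

definition shift_space :: "'a list set \<Rightarrow> (nat \<Rightarrow> 'a) set" where
  "shift_space F = {x. \<forall>u\<in>F. \<not> subword_seq u x}"

definition allowed :: "'a list set \<Rightarrow> 'a list \<Rightarrow> bool" where
  "allowed F w \<longleftrightarrow> (\<exists>x\<in>shift_space F. subword_seq w x)"

definition allowed_words :: "'a list set \<Rightarrow> nat \<Rightarrow> 'a list set" where
  "allowed_words F n = {w. length w = n \<and> allowed F w}"

definition longest :: "'a list set \<Rightarrow> nat" where
  "longest F = Max (length ` F)"

definition trans_mat :: "'a list set \<Rightarrow> 'a list \<Rightarrow> 'a list \<Rightarrow> nat" where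
  "trans_mat F X Y =
     (if drop (length X - (longest F - 2)) X = take (longest F - 2) Y
         \<and> X @ [last Y] \<in> allowed_words F (longest F)
      then 1 else 0)"

fun mat_power :: "'i set \<Rightarrow> ('i \<Rightarrow> 'i \<Rightarrow> nat) \<Rightarrow> nat \<Rightarrow> 'i \<Rightarrow> 'i \<Rightarrow> nat" where
  "mat_power I B 0 X Y = (if X = Y then 1 else 0)"
| "mat_power I B (Suc n) X Y = (\<Sum>Z\<in>I. mat_power I B n X Z * B Z Y)"

definition irreducible_mat :: "'i set \<Rightarrow> ('i \<Rightarrow> 'i \<Rightarrow> nat) \<Rightarrow> bool" where
  "irreducible_mat I B \<longleftrightarrow> (\<forall>X\<in>I. \<forall>Y\<in>I. \<exists>n\<ge>1. mat_power I B n X Y > 0)"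

text \<open>
  For \<open>F = {}\<close> there is no longest word, hence no transition matrix; the space is then the full
  shift, which is irreducible by convention.
\<close>

definition irreducible_shift :: "'a list set \<Rightarrow> bool" where
  "irreducible_shift F \<longleftrightarrow>
     F = {} \<or> irreducible_mat (allowed_words F (longest F - 1)) (trans_mat F)"

text \<open>Starting positions, counted from \<open>0\<close>, of the occurrences of \<open>v\<close> in \<open>u\<close>.\<close>

definition occurrences :: "'a list \<Rightarrow> 'a list \<Rightarrow> nat set" where
  "occurrences u v = {i. i + length v \<le> length u \<and> take (length v) (drop i u) = v}"

definition num_occ :: "'a list \<Rightarrow> 'a list \<Rightarrow> nat" where
  "num_occ u v = card (occurrences u v)"

definition weight :: "'a list set \<Rightarrow> ('a list \<Rightarrow> nat) \<Rightarrow> 'a list \<Rightarrow> real" where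
  "weight R m w = (\<Prod>r\<in>R. real (m r) ^ num_occ w r)"

definition weight_end :: "'a list set \<Rightarrow> ('a list \<Rightarrow> nat) \<Rightarrow> 'a list \<Rightarrow> 'a list \<Rightarrow> real" where
  "weight_end R m a w = weight R m w / weight R m a"

definition ends_only_with :: "'a list set \<Rightarrow> 'a list \<Rightarrow> 'a list \<Rightarrow> bool" where
  "ends_only_with F a w \<longleftrightarrow>
     suffix a w \<and> (\<forall>u\<in>F. \<forall>i\<in>occurrences w u. u = a \<and> i = length w - length a)"

definition f_count :: "'a list set \<Rightarrow> 'a list set \<Rightarrow> ('a list \<Rightarrow> nat) \<Rightarrow> nat \<Rightarrow> real" where
  "f_count F R m n = (if n = 0 then 1 else \<Sum>w\<in>allowed_words F n. weight R m w)"

definition g_count ::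
  "'a list set \<Rightarrow> 'a list set \<Rightarrow> ('a list \<Rightarrow> nat) \<Rightarrow> 'a list \<Rightarrow> nat \<Rightarrow> real" where
  "g_count F R m r n =
     (if n = 0 then 0 else \<Sum>w | w \<in> allowed_words F n \<and> suffix r w. weight R m w)"

definition fa_count ::
  "'a list set \<Rightarrow> 'a list set \<Rightarrow> ('a list \<Rightarrow> nat) \<Rightarrow> 'a list \<Rightarrow> nat \<Rightarrow> real" where
  "fa_count F R m a n =
     (if n = 0 then 0 else \<Sum>w | length w = n \<and> ends_only_with F a w. weight_end R m a w)"

text \<open>
  The generating functions are power series in \<open>z\<^sup>-\<^sup>1\<close>, multiplied by polynomials in \<open>z\<close>. They are
  formal Laurent series whose indeterminate \<open>fls_X\<close> plays the role of \<open>z\<^sup>-\<^sup>1\<close>, so that \<open>z\<close>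
  is \<open>fls_X_inv\<close>.
\<close>

definition gen_fun :: "(nat \<Rightarrow> real) \<Rightarrow> real fls" where
  "gen_fun c = fps_to_fls (Abs_fps c)"

text \<open>
  \<open>corr_coeff u v i\<close> is the entry \<open>c\<^sub>i\<close> of the correlation of \<open>u\<close> and \<open>v\<close>, where \<open>i\<close> counts
  from \<open>1\<close>; the condition compares only positions at which both words have a symbol.
\<close>

definition corr_coeff :: "'a list \<Rightarrow> 'a list \<Rightarrow> nat \<Rightarrow> 'b::comm_semiring_1" where
  "corr_coeff u v i =
     (if \<forall>k. i - 1 + k < length u \<and> k < length v \<longrightarrow> u ! (i - 1 + k) = v ! k then 1 else 0)"

definition corr_poly :: "'a list \<Rightarrow> 'a list \<Rightarrow> 'b::comm_semiring_1 \<Rightarrow> 'b" where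
  "corr_poly u v z = (\<Sum>i=1..length u. corr_coeff u v i * z ^ (length u - i))"

end

theory Submission
  imports Defs
begin

text \<open>
  Give a word its weight if it avoids \<open>F\<close> and weight \<open>0\<close> otherwise. Appending one symbol changes
  this number by \<open>increment\<close>: if the new word completes some \<open>r \<in> R\<close>, the change is \<open>1 - 1 / m r\<close>
  times the new weight; if it completes its first forbidden word \<open>a\<close>, the whole weight is lost. As
  \<open>F \<union> R\<close> is reduced, at most one of these happens. Summing over all words of length \<open>n + 1\<close> yields
  the first equation. Appending a whole word \<open>t\<close> symbol by symbol and telescoping yields the other
  two: the prefixes of \<open>t\<close> that can complete \<open>u \<in> F \<union> R\<close> are exactly those recorded by the
  correlation of \<open>u\<close> and \<open>t\<close>.
\<close>

section \<open>Occurrences\<close>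

text \<open>Trades index arithmetic for factorisations of \<open>w\<close>, which are easier to
  extend by a symbol.\<close>

lemma occurrences_iff: "i \<in> occurrences w v \<longleftrightarrow> (\<exists>ps ss. w = ps @ v @ ss \<and> length ps = i)"
proof
  assume "i \<in> occurrences w v"
  then have i: "i + length v \<le> length w" "take (length v) (drop i w) = v"
    by (auto simp: occurrences_def)
  have "w = take i w @ take (length v) (drop i w) @ drop (length v) (drop i w)"
    by (metis append_take_drop_id)
  with i have "w = take i w @ v @ drop (length v) (drop i w)" "length (take i w) = i"
    by auto
  then show "\<exists>ps ss. w = ps @ v @ ss \<and> length ps = i" by blast
qed (auto simp: occurrences_def)

lemma finite_occurrences [simp]: "finite (occurrences w v)"
  by (rule finite_subset[of _ "{..length w}"]) (auto simp: occurrences_def)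

lemma sublist_iff_occurrences: "sublist v w \<longleftrightarrow> occurrences w v \<noteq> {}"
  by (auto simp: sublist_def occurrences_iff set_eq_iff)

text \<open>In a factorisation \<open>w @ [x] = ps @ v @ ss\<close>, either \<open>ss\<close> is
  nonempty and the occurrence already lies in \<open>w\<close>, or \<open>ss\<close> is empty and
  \<open>v\<close> is a suffix.\<close>

lemma occurrences_snoc:
  assumes "v \<noteq> []"
  shows "occurrences (w @ [x]) v =
    occurrences w v \<union> (if suffix v (w @ [x]) then {length w + 1 - length v} else {})"
proof (rule set_eqI)
  fix i
  have *: "i \<in> occurrences (w @ [x]) v \<longleftrightarrow>
      i \<in> occurrences w v \<or> (suffix v (w @ [x]) \<and> i = length w + 1 - length v)"
  proof
    assume "i \<in> occurrences (w @ [x]) v"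
    then obtain ps ss where ps: "w @ [x] = ps @ v @ ss" "length ps = i"
      by (auto simp: occurrences_iff)
    show "i \<in> occurrences w v \<or> (suffix v (w @ [x]) \<and> i = length w + 1 - length v)"
    proof (cases ss rule: rev_cases)
      case Nil
      moreover from ps Nil have "length w + 1 = i + length v"
        by (metis append_Nil2 length_append length_append_singleton Suc_eq_plus1)
      ultimately show ?thesis using ps by (auto simp: suffix_def)
    next
      case (snoc ss' y)
      with ps have "w = ps @ v @ ss'" by simp
      with ps show ?thesis by (auto simp: occurrences_iff)
    qed
  next
    assume "i \<in> occurrences w v \<or> (suffix v (w @ [x]) \<and> i = length w + 1 - length v)"
    then show "i \<in> occurrences (w @ [x]) v"
    proof
      assume "i \<in> occurrences w v"
      then show ?thesis by (force simp: occurrences_iff)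
    next
      assume *: "suffix v (w @ [x]) \<and> i = length w + 1 - length v"
      then obtain ps where ps: "w @ [x] = ps @ v" by (auto simp: suffix_def)
      then have "length w + 1 = length ps + length v"
        by (metis length_append length_append_singleton Suc_eq_plus1)
      with * ps show ?thesis
        unfolding occurrences_iff by (intro exI[of _ ps] exI[of _ "[]"]) auto
    qed
  qed
  then show "i \<in> occurrences (w @ [x]) v \<longleftrightarrow>
      i \<in> occurrences w v \<union> (if suffix v (w @ [x]) then {length w + 1 - length v} else {})"
    by auto
qed

lemma num_occ_snoc:
  assumes "v \<noteq> []"
  shows "num_occ (w @ [x]) v = num_occ w v + (if suffix v (w @ [x]) then 1 else 0)"
proof -
  \<comment> \<open>An occurrence starting here runs one symbol past the end of \<open>w\<close>, so
    the union is disjoint and cardinalities add.\<close>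
  have "length w + 1 - length v \<notin> occurrences w v" if "suffix v (w @ [x])"
    using suffix_length_le[OF that] by (auto simp: occurrences_def)
  then show ?thesis
    by (auto simp: num_occ_def occurrences_snoc[OF assms])
qed

lemma num_occ_eq_0: "\<not> sublist v w \<Longrightarrow> num_occ w v = 0"
  by (simp add: num_occ_def sublist_iff_occurrences)

lemma sublist_snoc_iff:
  assumes "v \<noteq> []"
  shows "sublist v (w @ [x]) \<longleftrightarrow> sublist v w \<or> suffix v (w @ [x])"
  by (auto simp: sublist_iff_occurrences occurrences_snoc[OF assms])

text \<open>A forbidden word inside \<open>w\<close> would reappear in any sequence containing
  \<open>w\<close>. The converse, that avoiding words are allowed, enters the theorem as the
  hypothesis \<open>avoiding_allowed\<close>.\<close>

lemma allowed_not_sublist: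
  assumes "allowed F w" "a \<in> F"
  shows "\<not> sublist a w"
proof
  assume "sublist a w"
  then obtain ps ss where w: "w = ps @ a @ ss" by (auto simp: sublist_def)
  obtain x i where x: "x \<in> shift_space F" "map x [i..<i + length w] = w"
    using assms by (auto simp: allowed_def subword_seq_def)
  have "map x [i + length ps..<i + length ps + length a] = a"
  proof (rule nth_equalityI)
    fix k assume k: "k < length (map x [i + length ps..<i + length ps + length a])"
    then have "map x [i..<i + length w] ! (length ps + k) = w ! (length ps + k)"
      using x by simp
    with k w show "map x [i + length ps..<i + length ps + length a] ! k = a ! k"
      by (simp add: nth_append add.assoc)
  qed simp
  then have "subword_seq a x" unfolding subword_seq_def by blast
  with x assms show False by (auto simp: shift_space_def)
qed

text \<open>Of two suffixes of one word, one is a suffix of the other. Hence an appended symbol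
  completes at most one word of a reduced collection.\<close>

lemma reduced_suffix_unique:
  assumes "reduced C" "u \<in> C" "v \<in> C" "suffix u w" "suffix v w"
  shows "u = v"
  using assms suffix_same_cases[of u w v] by (metis reduced_def suffix_imp_sublist)

section \<open>Sums over words of a given length\<close>

text \<open>The sum runs over all words; restrictions are encoded by letting \<open>h\<close>
  vanish, so that reindexing never has to track a side condition.\<close>

definition word_sum :: "nat \<Rightarrow> ('a::finite list \<Rightarrow> real) \<Rightarrow> real" where
  "word_sum n h = (\<Sum>w | length w = n. h w)"

lemma finite_words [simp]: "finite {w :: 'a::finite list. length w = n}"
  using finite_lists_length_eq[of "UNIV :: 'a set" n] by simp

lemma word_sum_append:
  fixes h :: "'a::finite list \<Rightarrow> real"
  shows "word_sum n (\<lambda>w. h (w @ t)) = word_sum (n + length t) (\<lambda>w. if suffix t w then h w else 0)"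
proof -
  have "word_sum (n + length t) (\<lambda>w. if suffix t w then h w else 0)
      = (\<Sum>w | length w = n + length t \<and> suffix t w. h w)"
    unfolding word_sum_def by (rule sum.mono_neutral_cong_right) auto
  also have "\<dots> = (\<Sum>w | length w = n. h (w @ t))"
    by (rule sum.reindex_bij_witness[of _ "\<lambda>w. w @ t" "take n"]) (auto simp: suffix_def)
  finally show ?thesis by (simp add: word_sum_def)
qed

lemma word_sum_Suc:
  fixes h :: "'a::finite list \<Rightarrow> real"
  shows "word_sum (Suc n) h = (\<Sum>x\<in>UNIV. word_sum n (\<lambda>w. h (w @ [x])))"
proof -
  have snoc: "butlast w @ [last w] = w" if "length w = Suc n" for w :: "'a list"
    using that by (intro append_butlast_last_id) auto
  have "word_sum (Suc n) h = (\<Sum>p\<in>UNIV \<times> {w. length w = n}. h (snd p @ [fst p]))"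
    unfolding word_sum_def
    by (rule sum.reindex_bij_witness[of _ "\<lambda>p. snd p @ [fst p]" "\<lambda>w. (last w, butlast w)"])
      (auto simp: snoc)
  also have "\<dots> = (\<Sum>x\<in>UNIV. word_sum n (\<lambda>w. h (w @ [x])))"
    by (simp add: word_sum_def sum.cartesian_product case_prod_beta)
  finally show ?thesis .
qed

section \<open>Generating functions\<close>

lemma fls_nth_gen_fun: "fls_nth (gen_fun c) i = (if i < 0 then 0 else c (nat i))"
  by (simp add: gen_fun_def)

lemma gen_fun_add: "gen_fun (\<lambda>n. c n + d n) = gen_fun c + gen_fun d"
  by (rule fls_eqI) (simp add: fls_nth_gen_fun)

lemma gen_fun_diff: "gen_fun (\<lambda>n. c n - d n) = gen_fun c - gen_fun d"
  by (rule fls_eqI) (simp add: fls_nth_gen_fun)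

lemma gen_fun_cmult: "gen_fun (\<lambda>n. k * c n) = fls_const k * gen_fun c"
  by (rule fls_eqI) (simp add: fls_nth_gen_fun)

lemma gen_fun_zero: "gen_fun (\<lambda>n. 0) = 0"
  by (rule fls_eqI) (simp add: fls_nth_gen_fun)

lemma gen_fun_sum: "gen_fun (\<lambda>n. \<Sum>i\<in>I. c i n) = (\<Sum>i\<in>I. gen_fun (c i))"
  by (induction I rule: infinite_finite_induct) (auto simp: gen_fun_zero gen_fun_add)

text \<open>Multiplication by \<open>z ^ k\<close> moves coefficients down by \<open>k\<close>; the
  first \<open>k\<close> of them must vanish, or positive powers of \<open>z\<close> would
  appear.\<close>

lemma gen_fun_shift:
  assumes "\<And>j. j < k \<Longrightarrow> c j = 0"
  shows "fls_X_inv ^ k * gen_fun c = gen_fun (\<lambda>n. c (n + k))"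
proof (rule fls_eqI)
  fix i
  show "fls_nth (fls_X_inv ^ k * gen_fun c) i = fls_nth (gen_fun (\<lambda>n. c (n + k))) i"
    using assms[of "nat (i + int k)"]
    by (auto simp: fls_X_inv_power_times_conv_shift fls_nth_gen_fun nat_add_distrib)
qed

section \<open>Correlations in a reduced collection\<close>

text \<open>Here \<open>k\<close> is the length of the overlap: position
  \<open>length u + 1 - k\<close> leaves the last \<open>k\<close> symbols of \<open>u\<close>,
  which meet exactly the first \<open>k\<close> symbols of \<open>t\<close>.\<close>

lemma corr_coeff_eq_suffix:
  assumes "1 \<le> k" "k \<le> length u" "k \<le> length t"
  shows "corr_coeff u t (length u + 1 - k) = (if suffix (take k t) u then 1 else 0)"
proof -
  have "(\<forall>j. length u + 1 - k - 1 + j < length u \<and> j < length t \<longrightarrow>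
      u ! (length u + 1 - k - 1 + j) = t ! j) \<longleftrightarrow> drop (length u - k) u = take k t"
    using assms by (auto simp: list_eq_iff_nth_eq)
  also have "\<dots> \<longleftrightarrow> suffix (take k t) u"
    using assms by (auto simp: suffix_def) (metis append_take_drop_id)+
  finally show ?thesis by (simp add: corr_coeff_def)
qed

text \<open>When more than \<open>length t\<close> symbols of \<open>u\<close> remain, a match would
  place all of \<open>t\<close> inside the longer word \<open>u\<close>.\<close>

lemma corr_coeff_long_eq_0:
  assumes "reduced C" "u \<in> C" "t \<in> C" "k \<le> length u" "length t < k"
  shows "corr_coeff u t (length u + 1 - k) = 0"
proof (rule ccontr)
  assume "corr_coeff u t (length u + 1 - k) \<noteq> 0"
  then have *: "\<forall>j. length u + 1 - k - 1 + j < length u \<and> j < length t \<longrightarrow>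
      u ! (length u + 1 - k - 1 + j) = t ! j"
    unfolding corr_coeff_def by presburger
  have "take (length t) (drop (length u - k) u) = t"
    using * assms by (auto simp: list_eq_iff_nth_eq)
  then have "sublist t u"
    by (metis sublist_drop sublist_take sublist_order.order.trans)
  moreover have "t \<noteq> u" using assms by auto
  ultimately show False using assms by (auto simp: reduced_def)
qed

text \<open>If \<open>k \<le> length u\<close>, a word ending with \<open>u\<close> ends with
  \<open>take k t\<close> exactly when \<open>u\<close> does, so the condition becomes a constant
  factor. If \<open>k > length u\<close>, then \<open>u\<close> would lie inside \<open>t\<close>,
  contradicting reducedness.\<close>

lemma word_sum_append_take:
  fixes h :: "'a::finite list \<Rightarrow> real"
  assumes C: "reduced C" "u \<in> C" "t \<in> C"
    and h: "\<And>w. h w \<noteq> 0 \<Longrightarrow> suffix u w"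
    and k: "1 \<le> k" "k \<le> length t"
  shows "word_sum n (\<lambda>w. h (w @ take k t)) =
    (if k \<le> length u then corr_coeff u t (length u + 1 - k) * word_sum (n + k) h else 0)"
proof (cases "k \<le> length u")
  case True
  have "(if suffix (take k t) w then h w else 0) = (if suffix (take k t) u then 1 else 0) * h w" for w
  proof (cases "h w = 0")
    case False
    then have "suffix u w" by (rule h)
    then have "suffix (take k t) w \<longleftrightarrow> suffix (take k t) u"
      using True k suffix_length_suffix[of "take k t" w u] by (auto intro: suffix_order.trans)
    then show ?thesis by simp
  qed auto
  then have "word_sum n (\<lambda>w. h (w @ take k t)) =
      word_sum (n + k) (\<lambda>w. (if suffix (take k t) u then 1 else 0) * h w)"
    using k by (simp add: word_sum_append min_def)
  with True show ?thesis
    unfolding corr_coeff_eq_suffix[OF k(1) True k(2)] by (simp add: word_sum_def sum_distrib_left)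
next
  case False
  have "h (w @ take k t) = 0" for w
  proof (rule ccontr)
    assume "h (w @ take k t) \<noteq> 0"
    then have "suffix u (w @ take k t)" by (rule h)
    then have "suffix u (take k t)"
      using False k suffix_length_suffix[of u "w @ take k t" "take k t"] by (auto simp: suffix_def)
    then have "sublist u t"
      by (meson suffix_imp_sublist sublist_take sublist_order.order.trans)
    moreover have "u \<noteq> t" using False k by auto
    ultimately show False using C by (auto simp: reduced_def)
  qed
  with False show ?thesis by (simp add: word_sum_def)
qed

text \<open>The extra factor \<open>z\<close> turns the exponent \<open>length u - i\<close> into
  the overlap length \<open>k = length u + 1 - i\<close>, so each term of the polynomial is a shift
  that stands for appending \<open>take k t\<close>.\<close>

lemma corr_poly_times_gen_fun:
  fixes h :: "'a::finite list \<Rightarrow> real"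
  assumes C: "reduced C" "u \<in> C" "t \<in> C"
    and h: "\<And>w. h w \<noteq> 0 \<Longrightarrow> suffix u w"
  shows "fls_X_inv * corr_poly u t fls_X_inv * gen_fun (\<lambda>n. word_sum n h) =
    gen_fun (\<lambda>n. \<Sum>k=1..length t. word_sum n (\<lambda>w. h (w @ take k t)))"
proof -
  define \<gamma> where "\<gamma> k = (corr_coeff u t (length u + 1 - k) :: real)" for k
  have \<gamma>: "corr_coeff u t (length u + 1 - k) = fls_const (\<gamma> k)" for k
    by (simp add: \<gamma>_def corr_coeff_def)
  have \<gamma>_long: "\<gamma> k = 0" if "k \<le> length u" "length t < k" for k
    unfolding \<gamma>_def using that by (rule corr_coeff_long_eq_0[OF C])
  have \<gamma>_short: "word_sum n (\<lambda>w. h (w @ take k t)) = (if k \<le> length u then \<gamma> k * word_sum (n + k) h else 0)"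
    if "1 \<le> k" "k \<le> length t" for k n
    unfolding \<gamma>_def using h that by (rule word_sum_append_take[OF C])
  \<comment> \<open>No word shorter than \<open>u\<close> ends with \<open>u\<close>; this permits
    shifts by every \<open>k \<le> length u\<close>.\<close>
  have zero: "word_sum j h = 0" if "j < length u" for j
    unfolding word_sum_def using that h suffix_length_le by (intro sum.neutral) fastforce
  have "corr_poly u t (fls_X_inv :: real fls) = (\<Sum>k=1..length u. fls_const (\<gamma> k) * fls_X_inv ^ (k - 1))"
    unfolding corr_poly_def \<gamma>[symmetric]
    by (rule sum.reindex_bij_witness[of _ "\<lambda>k. length u + 1 - k" "\<lambda>k. length u + 1 - k"]) auto
  then have "fls_X_inv * corr_poly u t fls_X_inv * gen_fun (\<lambda>n. word_sum n h) =
      (\<Sum>k=1..length u. fls_const (\<gamma> k) * (fls_X_inv * fls_X_inv ^ (k - 1) * gen_fun (\<lambda>n. word_sum n h)))"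
    by (simp add: sum_distrib_left sum_distrib_right mult_ac)
  also have "\<dots> = (\<Sum>k=1..length u. gen_fun (\<lambda>n. \<gamma> k * word_sum (n + k) h))"
  proof (rule sum.cong)
    fix k assume k: "k \<in> {1..length u}"
    then have "fls_X_inv * fls_X_inv ^ (k - 1) = (fls_X_inv :: real fls) ^ k"
      by (cases k) auto
    moreover have "fls_X_inv ^ k * gen_fun (\<lambda>n. word_sum n h) = gen_fun (\<lambda>n. word_sum (n + k) h)"
      using k zero by (intro gen_fun_shift) auto
    ultimately show "fls_const (\<gamma> k) * (fls_X_inv * fls_X_inv ^ (k - 1) * gen_fun (\<lambda>n. word_sum n h))
        = gen_fun (\<lambda>n. \<gamma> k * word_sum (n + k) h)"
      by (simp add: gen_fun_cmult)
  qed simp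
  also have "\<dots> = gen_fun (\<lambda>n. \<Sum>k=1..length u. \<gamma> k * word_sum (n + k) h)"
    by (simp add: gen_fun_sum)
  also have "(\<lambda>n. \<Sum>k=1..length u. \<gamma> k * word_sum (n + k) h) =
      (\<lambda>n. \<Sum>k=1..length t. word_sum n (\<lambda>w. h (w @ take k t)))"
  proof
    fix n
    \<comment> \<open>The two ranges differ, but only overlaps no longer than either word contribute
      to either sum.\<close>
    have "(\<Sum>k=1..length u. \<gamma> k * word_sum (n + k) h) =
        (\<Sum>k\<in>{1..length u} \<inter> {1..length t}. \<gamma> k * word_sum (n + k) h)"
      by (rule sum.mono_neutral_right) (auto simp: \<gamma>_long)
    also have "\<dots> = (\<Sum>k=1..length t. word_sum n (\<lambda>w. h (w @ take k t)))"
      by (rule sum.mono_neutral_cong_left) (auto simp: \<gamma>_short)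
    finally show "(\<Sum>k=1..length u. \<gamma> k * word_sum (n + k) h) =
        (\<Sum>k=1..length t. word_sum n (\<lambda>w. h (w @ take k t)))" .
  qed
  finally show ?thesis .
qed

section \<open>Appending symbols\<close>

text \<open>The assumption \<open>disjoint\<close> is separate because \<open>reduced\<close>
  compares distinct words only and would let a word be both forbidden and repeated.\<close>

locale weighted_words =
  fixes F R :: "'a::finite list set" and m :: "'a list \<Rightarrow> nat"
  assumes nonempty: "[] \<notin> F \<union> R"
    and reduced: "reduced (F \<union> R)"
    and disjoint: "F \<inter> R = {}"
    and multiplicity_pos: "\<And>r. r \<in> R \<Longrightarrow> m r > 0"
begin

section \<open>Weights of words and their change under appending\<close>

definition avoids :: "'a list \<Rightarrow> bool" where
  "avoids w \<longleftrightarrow> (\<forall>a\<in>F. \<not> sublist a w)"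

definition wt :: "'a list \<Rightarrow> real" where
  "wt w = (if avoids w then weight R m w else 0)"

text \<open>For forbidden \<open>r\<close> this is identically 0, which lets
  \<open>gen_wt_word\<close> treat forbidden and repeated words alike.\<close>

definition wt_rep :: "'a list \<Rightarrow> 'a list \<Rightarrow> real" where
  "wt_rep r w = (if suffix r w then wt w else 0)"

definition wt_forb :: "'a list \<Rightarrow> 'a list \<Rightarrow> real" where
  "wt_forb a w = (if ends_only_with F a w then weight_end R m a w else 0)"

definition increment :: "'a list \<Rightarrow> real" where
  "increment w = (\<Sum>r\<in>R. (1 - 1 / real (m r)) * wt_rep r w) - (\<Sum>a\<in>F. wt_forb a w)"

lemma finite_F: "finite F" and finite_R: "finite R"
  using reduced by (auto simp: reduced_def)

lemma avoids_snoc: "avoids (w @ [x]) \<longleftrightarrow> avoids w \<and> (\<forall>a\<in>F. \<not> suffix a (w @ [x]))"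
proof -
  have "a \<noteq> []" if "a \<in> F" for a using nonempty that by auto
  then show ?thesis by (auto simp: avoids_def sublist_snoc_iff)
qed

text \<open>The final \<open>a\<close> uses the new symbol, so it is not an occurrence within
  \<open>w\<close>. Conversely, if \<open>w\<close> avoids \<open>F\<close>, any forbidden
  occurrence is a suffix, hence equals \<open>a\<close> by reducedness.\<close>

lemma ends_only_with_snoc:
  assumes "a \<in> F"
  shows "ends_only_with F a (w @ [x]) \<longleftrightarrow> avoids w \<and> suffix a (w @ [x])"
proof
  assume L: "ends_only_with F a (w @ [x])"
  have "\<not> sublist b w" if "b \<in> F" for b
  proof
    assume "sublist b w"
    then obtain i where i: "i \<in> occurrences w b" by (auto simp: sublist_iff_occurrences)
    have "b \<noteq> []" using nonempty that by auto
    with i have "i \<in> occurrences (w @ [x]) b" by (simp add: occurrences_snoc)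
    with L that have "b = a" "i = length w + 1 - length a"
      by (auto simp: ends_only_with_def)
    with i show False by (auto simp: occurrences_def)
  qed
  with L show "avoids w \<and> suffix a (w @ [x])" by (auto simp: avoids_def ends_only_with_def)
next
  assume R: "avoids w \<and> suffix a (w @ [x])"
  have "b = a \<and> i = length (w @ [x]) - length a"
    if "b \<in> F" "i \<in> occurrences (w @ [x]) b" for b i
  proof -
    have "b \<noteq> []" using nonempty that by auto
    moreover have "occurrences w b = {}"
      using R that by (auto simp: avoids_def sublist_iff_occurrences)
    ultimately have "suffix b (w @ [x])" "i = length w + 1 - length b"
      using that by (auto simp: occurrences_snoc split: if_splits)
    moreover from this have "b = a"
      using reduced_suffix_unique[OF reduced] R that assms by blast
    ultimately show ?thesis by simp
  qed
  with R show "ends_only_with F a (w @ [x])" by (auto simp: ends_only_with_def)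
qed

lemma weight_snoc:
  "weight R m (w @ [x]) =
    weight R m w * (\<Prod>r\<in>R. if suffix r (w @ [x]) then real (m r) else 1)"
  unfolding weight_def prod.distrib[symmetric]
proof (rule prod.cong)
  fix r assume "r \<in> R"
  then have "r \<noteq> []" using nonempty by auto
  then show "real (m r) ^ num_occ (w @ [x]) r =
      real (m r) ^ num_occ w r * (if suffix r (w @ [x]) then real (m r) else 1)"
    by (simp add: num_occ_snoc del: suffix_snoc)
qed simp

text \<open>By uniqueness of the completed word the product in \<open>weight_snoc\<close> has at
  most one nontrivial factor; it has none when \<open>u\<close> is forbidden.\<close>

lemma weight_snoc_suffix:
  assumes "u \<in> F \<union> R" "suffix u (w @ [x])"
  shows "weight R m (w @ [x]) = weight R m w * (if u \<in> R then real (m u) else 1)"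
proof -
  have "suffix r (w @ [x]) \<longleftrightarrow> r = u" if "r \<in> R" for r
    using reduced_suffix_unique[OF reduced] assms that by blast
  then have prod: "(\<Prod>r\<in>R. if suffix r (w @ [x]) then real (m r) else 1) =
      (\<Prod>r\<in>R. if r = u then real (m r) else 1)"
    by (intro prod.cong) auto
  show ?thesis unfolding weight_snoc prod by (simp add: finite_R)
qed

text \<open>Reducedness keeps repeated words out of forbidden ones, so the denominator in
  \<open>weight_end\<close> is 1.\<close>

lemma weight_forbidden:
  assumes "a \<in> F"
  shows "weight R m a = 1"
proof -
  have "num_occ a r = 0" if "r \<in> R" for r
  proof (rule num_occ_eq_0)
    have "r \<noteq> a" using disjoint assms that by auto
    then show "\<not> sublist r a" using reduced assms that by (simp add: reduced_def)
  qed
  then show ?thesis by (simp add: weight_def)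
qed

lemma wt_snoc: "wt (w @ [x]) = wt w + increment (w @ [x])"
proof (cases "avoids w")
  case False
  then have "wt_rep r (w @ [x]) = 0" for r
    by (auto simp: wt_rep_def wt_def avoids_snoc)
  with False show ?thesis
    by (simp add: wt_def increment_def wt_forb_def avoids_snoc ends_only_with_snoc)
next
  case w: True
  \<comment> \<open>Completing \<open>b\<close> completes no repeated word, so the extended word
    still has weight \<open>weight R m w\<close>: all of \<open>wt w\<close> is lost.\<close>
  have forb: "wt_forb b (w @ [x]) = (if suffix b (w @ [x]) then wt w else 0)" if "b \<in> F" for b
    using that w disjoint
    by (auto simp: wt_forb_def ends_only_with_snoc weight_end_def weight_forbidden
        weight_snoc_suffix[of b] wt_def)
  show ?thesis
  proof (cases "\<exists>u\<in>F \<union> R. suffix u (w @ [x])")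
    case False
    then have "(\<Prod>r\<in>R. if suffix r (w @ [x]) then real (m r) else 1) = 1"
      by (intro prod.neutral) auto
    then have "weight R m (w @ [x]) = weight R m w" unfolding weight_snoc by simp
    then have "wt (w @ [x]) = wt w"
      using False w by (simp add: wt_def avoids_snoc del: suffix_snoc)
    moreover have "increment (w @ [x]) = 0"
      using False forb by (simp add: increment_def wt_rep_def del: suffix_snoc)
    ultimately show ?thesis by simp
  next
    case True
    then obtain u where u: "u \<in> F \<union> R" "suffix u (w @ [x])" by blast
    have uniq: "suffix v (w @ [x]) \<longleftrightarrow> v = u" if "v \<in> F \<union> R" for v
      using reduced_suffix_unique[OF reduced] u that by blast
    have "(\<Sum>a\<in>F. wt_forb a (w @ [x])) = (\<Sum>a\<in>F. if a = u then wt w else 0)"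
      using forb uniq by (intro sum.cong) auto
    then have sumF: "(\<Sum>a\<in>F. wt_forb a (w @ [x])) = (if u \<in> F then wt w else 0)"
      by (simp add: finite_F)
    have "(\<Sum>r\<in>R. (1 - 1 / real (m r)) * wt_rep r (w @ [x])) =
        (\<Sum>r\<in>R. if r = u then (1 - 1 / real (m u)) * wt (w @ [x]) else 0)"
      using uniq by (intro sum.cong) (auto simp: wt_rep_def)
    then have sumR: "(\<Sum>r\<in>R. (1 - 1 / real (m r)) * wt_rep r (w @ [x])) =
        (if u \<in> R then (1 - 1 / real (m u)) * wt (w @ [x]) else 0)"
      by (simp add: finite_R)
    show ?thesis
    proof (cases "u \<in> F")
      case True
      then have "u \<notin> R" "\<not> avoids (w @ [x])" using disjoint u by (auto simp: avoids_snoc)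
      with True show ?thesis by (simp add: increment_def sumF sumR wt_def)
    next
      case False
      then have "u \<in> R" using u by simp
      have "avoids (w @ [x])" using w uniq False by (auto simp: avoids_snoc)
      \<comment> \<open>Hence \<open>(1 - 1 / m u)\<close> times the new weight is the new weight
        minus the old one.\<close>
      then have "wt (w @ [x]) = wt w * real (m u)"
        using w \<open>u \<in> R\<close> u by (simp add: wt_def weight_snoc_suffix[of u])
      with False \<open>u \<in> R\<close> multiplicity_pos[of u] show ?thesis
        unfolding increment_def sumF sumR by (simp add: field_simps)
    qed
  qed
qed

text \<open>Telescoping of \<open>wt_snoc\<close>. It remains valid when a forbidden word is
  completed midway, because all later increments are then 0.\<close>

lemma wt_append: "wt (w @ t) = wt w + (\<Sum>k=1..length t. increment (w @ take k t))"
proof (induction t rule: rev_induct)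
  case (snoc x t)
  have "(\<Sum>k=1..length t. increment (w @ take k (t @ [x]))) =
      (\<Sum>k=1..length t. increment (w @ take k t))"
    by (rule sum.cong) auto
  then show ?case
    using snoc wt_snoc[of "w @ t" x] by simp
qed simp

section \<open>The linear equations for the generating functions of \<open>wt\<close>,
  \<open>wt_rep\<close> and \<open>wt_forb\<close>\<close>

abbreviation gen_wt :: "real fls" where
  "gen_wt \<equiv> gen_fun (\<lambda>n. word_sum n wt)"

abbreviation gen_rep :: "'a list \<Rightarrow> real fls" where
  "gen_rep r \<equiv> gen_fun (\<lambda>n. word_sum n (wt_rep r))"

abbreviation gen_forb :: "'a list \<Rightarrow> real fls" where
  "gen_forb a \<equiv> gen_fun (\<lambda>n. word_sum n (wt_forb a))"

text \<open>The map \<open>p\<close> is the identity when one symbol is appended, and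
  \<open>\<lambda>w. w @ take k t\<close> when a word is.\<close>

lemma word_sum_increment:
  "word_sum n (\<lambda>w. increment (p w)) =
    (\<Sum>r\<in>R. (1 - 1 / real (m r)) * word_sum n (\<lambda>w. wt_rep r (p w)))
      - (\<Sum>a\<in>F. word_sum n (\<lambda>w. wt_forb a (p w)))"
  unfolding word_sum_def increment_def sum_subtractf sum_distrib_left
  by (intro arg_cong2[where f = "(-)"] sum.swap)

lemma wt_rep_Nil: "r \<in> R \<Longrightarrow> wt_rep r [] = 0"
  using nonempty by (auto simp: wt_rep_def)

lemma wt_forb_Nil: "a \<in> F \<Longrightarrow> wt_forb a [] = 0"
  using nonempty by (auto simp: wt_forb_def ends_only_with_def)

lemma wt_Nil: "wt [] = 1"
proof -
  have "avoids []" using nonempty by (auto simp: avoids_def)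
  moreover have "num_occ [] r = 0" if "r \<in> R" for r
    using nonempty that by (intro num_occ_eq_0) auto
  ultimately show ?thesis by (simp add: wt_def weight_def)
qed

lemma word_sum_0: "word_sum 0 h = h []"
  by (simp add: word_sum_def)

text \<open>This is \<open>wt_snoc\<close> summed over all words of length \<open>n + 1\<close>. The
  right-hand side comes from the empty word, which is no extension of another word.\<close>

lemma gen_wt_symbol:
  "(fls_X_inv - of_nat CARD('a)) * gen_wt
    - (\<Sum>r\<in>R. fls_X_inv * fls_const (1 - 1 / real (m r)) * gen_rep r)
    + (\<Sum>a\<in>F. fls_X_inv * gen_forb a) = fls_X_inv"
proof -
  have step: "word_sum (Suc n) wt = real CARD('a) * word_sum n wt + word_sum (Suc n) increment" for n
  proof -
    have "word_sum (Suc n) wt = (\<Sum>x\<in>UNIV. word_sum n (\<lambda>w. wt w + increment (w @ [x])))"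
      by (simp add: word_sum_Suc wt_snoc)
    also have "\<dots> = real CARD('a) * word_sum n wt + (\<Sum>x\<in>UNIV. word_sum n (\<lambda>w. increment (w @ [x])))"
      by (simp add: word_sum_def sum.distrib)
    finally show ?thesis by (simp only: word_sum_Suc[of n increment])
  qed
  \<comment> \<open>The constant term \<open>wt [] = 1\<close> is removed so that the shift applies;
    it returns as the lone \<open>fls_X_inv\<close>.\<close>
  have wt: "fls_X_inv * (gen_wt - 1) = gen_fun (\<lambda>n. word_sum (Suc n) wt)"
  proof -
    have "gen_wt - 1 = gen_fun (\<lambda>n. if n = 0 then 0 else word_sum n wt)"
      by (rule fls_eqI) (auto simp: fls_nth_gen_fun word_sum_0 wt_Nil)
    with gen_fun_shift[of 1 "\<lambda>n. if n = 0 then 0 else word_sum n wt"] show ?thesis by simp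
  qed
  have rep: "fls_X_inv * gen_rep r = gen_fun (\<lambda>n. word_sum (Suc n) (wt_rep r))" if "r \<in> R" for r
    using gen_fun_shift[of 1 "\<lambda>n. word_sum n (wt_rep r)"] that by (simp add: word_sum_0 wt_rep_Nil)
  have forb: "fls_X_inv * gen_forb a = gen_fun (\<lambda>n. word_sum (Suc n) (wt_forb a))" if "a \<in> F" for a
    using gen_fun_shift[of 1 "\<lambda>n. word_sum n (wt_forb a)"] that by (simp add: word_sum_0 wt_forb_Nil)
  have "gen_fun (\<lambda>n. word_sum (Suc n) wt) = fls_const (real CARD('a)) * gen_wt
      + ((\<Sum>r\<in>R. fls_const (1 - 1 / real (m r)) * gen_fun (\<lambda>n. word_sum (Suc n) (wt_rep r)))
      - (\<Sum>a\<in>F. gen_fun (\<lambda>n. word_sum (Suc n) (wt_forb a))))"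
    by (simp add: step word_sum_increment[where p = "\<lambda>w. w", simplified]
        gen_fun_add gen_fun_diff gen_fun_sum gen_fun_cmult)
  also have "\<dots> = of_nat CARD('a) * gen_wt
      + ((\<Sum>r\<in>R. fls_X_inv * fls_const (1 - 1 / real (m r)) * gen_rep r)
      - (\<Sum>a\<in>F. fls_X_inv * gen_forb a))"
    by (simp add: rep[symmetric] forb[symmetric] fls_of_nat mult_ac)
  finally show ?thesis
    unfolding wt[symmetric] by (simp add: algebra_simps)
qed

text \<open>This is \<open>wt_append\<close> summed over \<open>w\<close>: the words
  \<open>w @ t\<close> are exactly those ending with \<open>t\<close>, and the increments become
  correlation polynomials.\<close>

lemma gen_wt_word:
  assumes t: "t \<in> F \<union> R"
  shows "gen_wt + (\<Sum>r\<in>R. fls_X_inv * fls_const (1 - 1 / real (m r)) * corr_poly r t fls_X_inv * gen_rep r)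
      - (\<Sum>a\<in>F. fls_X_inv * corr_poly a t fls_X_inv * gen_forb a)
    = fls_X_inv ^ length t * gen_rep t"
proof -
  let ?app = "\<lambda>h n. \<Sum>k=1..length t. word_sum n (\<lambda>w. h (w @ take k t))"
  have rep: "fls_X_inv * corr_poly r t fls_X_inv * gen_rep r = gen_fun (?app (wt_rep r))" if "r \<in> R" for r
    using that t by (intro corr_poly_times_gen_fun[OF reduced]) (auto simp: wt_rep_def split: if_splits)
  have forb: "fls_X_inv * corr_poly a t fls_X_inv * gen_forb a = gen_fun (?app (wt_forb a))" if "a \<in> F" for a
    using that t by (intro corr_poly_times_gen_fun[OF reduced])
      (auto simp: wt_forb_def ends_only_with_def split: if_splits)
  have step: "word_sum (n + length t) (wt_rep t) = word_sum n wt +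
      ((\<Sum>r\<in>R. (1 - 1 / real (m r)) * ?app (wt_rep r) n) - (\<Sum>a\<in>F. ?app (wt_forb a) n))" for n
  proof -
    have "word_sum (n + length t) (wt_rep t) = word_sum n (\<lambda>w. wt (w @ t))"
      unfolding word_sum_append wt_rep_def ..
    also have "\<dots> = word_sum n wt + (\<Sum>k=1..length t. word_sum n (\<lambda>w. increment (w @ take k t)))"
      unfolding word_sum_def wt_append sum.distrib by (intro arg_cong2[where f = "(+)"] refl sum.swap)
    also have "(\<Sum>k=1..length t. word_sum n (\<lambda>w. increment (w @ take k t))) =
        (\<Sum>r\<in>R. (1 - 1 / real (m r)) * ?app (wt_rep r) n) - (\<Sum>a\<in>F. ?app (wt_forb a) n)"
      unfolding word_sum_increment sum_subtractf sum_distrib_left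
      by (intro arg_cong2[where f = "(-)"] sum.swap)
    finally show ?thesis .
  qed
  have "word_sum j (wt_rep t) = 0" if "j < length t" for j
    unfolding word_sum_def wt_rep_def using that by (intro sum.neutral) (auto dest: suffix_length_le)
  then have "fls_X_inv ^ length t * gen_rep t = gen_fun (\<lambda>n. word_sum (n + length t) (wt_rep t))"
    by (rule gen_fun_shift)
  also have "\<dots> = gen_wt + ((\<Sum>r\<in>R. fls_const (1 - 1 / real (m r)) * gen_fun (?app (wt_rep r)))
      - (\<Sum>a\<in>F. gen_fun (?app (wt_forb a))))"
    unfolding step gen_fun_add gen_fun_diff gen_fun_sum[of _ R] gen_fun_sum[of _ F] gen_fun_cmult ..
  also have "\<dots> = gen_wt
      + ((\<Sum>r\<in>R. fls_X_inv * fls_const (1 - 1 / real (m r)) * corr_poly r t fls_X_inv * gen_rep r)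
      - (\<Sum>a\<in>F. fls_X_inv * corr_poly a t fls_X_inv * gen_forb a))"
    using rep forb
    by (intro arg_cong2[where f = "(+)"] arg_cong2[where f = "(-)"] sum.cong refl) (simp_all add: mult_ac)
  finally show ?thesis by simp
qed

text \<open>A word ending with \<open>a\<close> does not avoid \<open>F\<close>. The right-hand side
  of \<open>gen_wt_word\<close> thus vanishes for forbidden \<open>t\<close>, giving the third
  equation.\<close>

lemma gen_rep_forbidden:
  assumes "a \<in> F"
  shows "gen_rep a = 0"
proof -
  have "wt_rep a w = 0" for w
    using assms suffix_imp_sublist by (auto simp: wt_rep_def wt_def avoids_def)
  then show ?thesis by (simp add: word_sum_def gen_fun_zero)
qed

end

section \<open>Identification of the counting functions with the weight sums\<close>

theorem theorem4p3:
  fixes F R :: "'a::finite list set"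
    and m :: "'a list \<Rightarrow> nat"
  assumes q_ge_2: "CARD('a) \<ge> 2"
    and F_length: "\<forall>a\<in>F. length a \<ge> 2"
    and symbols_allowed: "\<forall>x. allowed F [x]"
    and irred: "irreducible_shift F"
    and avoiding_allowed: "\<forall>w. (\<forall>a\<in>F. \<not> sublist a w) \<longrightarrow> allowed F w"
    and R_nonempty_words: "[] \<notin> R"
    and R_allowed: "\<forall>r\<in>R. allowed F r"
    and multiplicities: "\<forall>r\<in>R. m r > 1"
    and reduced_union: "reduced (F \<union> R)"
  shows
    "let z = fls_X_inv :: real fls;
         FF = gen_fun (f_count F R m);
         G = (\<lambda>r. gen_fun (g_count F R m r));
         FA = (\<lambda>a. gen_fun (fa_count F R m a));
         c = (\<lambda>r. fls_const (1 - 1 / real (m r)))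
     in
       (z - of_nat CARD('a)) * FF - (\<Sum>r\<in>R. z * c r * G r) + (\<Sum>a\<in>F. z * FA a) = z
     \<and> (\<forall>r'\<in>R.
          FF + (\<Sum>r\<in>R. (z * c r * corr_poly r r' z
                          - z ^ length r * (if r = r' then 1 else 0)) * G r)
             - (\<Sum>a\<in>F. z * corr_poly a r' z * FA a) = 0)
     \<and> (\<forall>a'\<in>F.
          FF + (\<Sum>r\<in>R. (z * c r * corr_poly r a' z) * G r)
             - (\<Sum>a\<in>F. z * corr_poly a a' z * FA a) = 0)"
proof -
  interpret weighted_words F R m
  proof
    show "[] \<notin> F \<union> R" using F_length R_nonempty_words by auto
    \<comment> \<open>A common word would be allowed although it contains a forbidden word, namely
      itself.\<close>
    show "F \<inter> R = {}" using R_allowed allowed_not_sublist by blast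
    show "m r > 0" if "r \<in> R" for r using multiplicities that by auto
  qed (rule reduced_union)
  \<comment> \<open>Here \<open>avoiding_allowed\<close> replaces membership in the language of the
    shift by the finite condition of avoiding \<open>F\<close>.\<close>
  have allowed: "allowed F w \<longleftrightarrow> avoids w" for w
    using avoiding_allowed allowed_not_sublist by (auto simp: avoids_def)
  have FF: "f_count F R m = (\<lambda>n. word_sum n wt)"
  proof
    fix n
    have "(\<Sum>w\<in>allowed_words F n. weight R m w) = word_sum n wt"
      unfolding word_sum_def by (rule sum.mono_neutral_cong_left) (auto simp: allowed_words_def allowed wt_def)
    \<comment> \<open>The convention \<open>f(0) = 1\<close> agrees with \<open>wt [] = 1\<close>;
      the zero conventions for the other counts agree because words of \<open>F\<close> and
      \<open>R\<close> are nonempty.\<close>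
    then show "f_count F R m n = word_sum n wt"
      by (auto simp: f_count_def word_sum_0 wt_Nil)
  qed
  have G: "g_count F R m r = (\<lambda>n. word_sum n (wt_rep r))" if "r \<in> R" for r
  proof
    fix n
    have "(\<Sum>w | w \<in> allowed_words F n \<and> suffix r w. weight R m w) = word_sum n (wt_rep r)"
      unfolding word_sum_def
      by (rule sum.mono_neutral_cong_left) (auto simp: allowed_words_def allowed wt_def wt_rep_def)
    then show "g_count F R m r n = word_sum n (wt_rep r)"
      using that by (auto simp: g_count_def word_sum_0 wt_rep_Nil)
  qed
  have FA: "fa_count F R m a = (\<lambda>n. word_sum n (wt_forb a))" if "a \<in> F" for a
  proof
    fix n
    have "(\<Sum>w | length w = n \<and> ends_only_with F a w. weight_end R m a w) = word_sum n (wt_forb a)"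
      unfolding word_sum_def
      by (rule sum.mono_neutral_cong_left) (auto simp: wt_forb_def)
    then show "fa_count F R m a n = word_sum n (wt_forb a)"
      using that by (auto simp: fa_count_def word_sum_0 wt_forb_Nil)
  qed
  \<comment> \<open>The Kronecker term contributes only at \<open>r = r'\<close> and is exactly the
    right-hand side of \<open>gen_wt_word\<close>.\<close>
  have kronecker: "(\<Sum>r\<in>R. (p r - fls_X_inv ^ length r * (if r = r' then 1 else 0)) * gen_rep r) =
      (\<Sum>r\<in>R. p r * gen_rep r) - fls_X_inv ^ length r' * gen_rep r'" if "r' \<in> R" for p r'
  proof -
    have "(\<Sum>r\<in>R. (p r - fls_X_inv ^ length r * (if r = r' then 1 else 0)) * gen_rep r) =
        (\<Sum>r\<in>R. p r * gen_rep r - (if r = r' then fls_X_inv ^ length r * gen_rep r else 0))"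
      by (rule sum.cong) (auto simp: left_diff_distrib)
    then show ?thesis
      using that by (simp add: sum_subtractf finite_R)
  qed
  have eq2: "gen_wt + (\<Sum>r\<in>R. (fls_X_inv * fls_const (1 - 1 / real (m r)) * corr_poly r r' fls_X_inv
        - fls_X_inv ^ length r * (if r = r' then 1 else 0)) * gen_rep r)
      - (\<Sum>a\<in>F. fls_X_inv * corr_poly a r' fls_X_inv * gen_forb a) = 0" if "r' \<in> R" for r'
    unfolding kronecker[OF that] using gen_wt_word[of r'] that by (simp add: algebra_simps)
  have eq3: "gen_wt
      + (\<Sum>r\<in>R. fls_X_inv * fls_const (1 - 1 / real (m r)) * corr_poly r a' fls_X_inv * gen_rep r)
      - (\<Sum>a\<in>F. fls_X_inv * corr_poly a a' fls_X_inv * gen_forb a) = 0" if "a' \<in> F" for a'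
    using gen_wt_word[of a'] gen_rep_forbidden[of a'] that by simp
  show ?thesis
    unfolding Let_def using gen_wt_symbol eq2 eq3 by (simp add: FF G FA cong: sum.cong)
qed

end
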